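(* Let $G=(V,E)$ be a graph satisfying the standing assumptions, and let $\bar G=(\bar V,\bar E)$ be the derived graph defined below. Let $u,v\in V$ with $\tau(u)=\tau(v)=3$. Then: (1) if $\min_u=\min_v$, then $\min_{\bar u}=\min_{\bar v}$ (minima computed in $\bar G$); (2) if $\min_u\prec\min_v$, then $\min_{\bar u}\prec'\min_{\bar v}$.
   Context: Standing assumptions: $\Sigma$ is a finite alphabet with a total order $\preceq$; $G=(V,E)$ is finite, $E\subseteq V\times V\times\Sigma$, every character labels some edge, every node has an incoming edge, all edges entering a node $u$ have the same label $\lambda(u)$ (edges are written $(u,v)$), and $G$ is deterministic (for each $u$ and $a$ at most one $v$ with $(u,v)\in E$, $\lambda(v)=a$). Strings in $\Sigma^\omega$ (right-infinite) are ordered lexicographically; for a string $\alpha$, $\alpha[i]$ is its $i$-th character and $\alpha[i,j]=\alpha[i]\cdots\alpha[j]$ (empty if $j<i$). An occurrence of $\alpha\in\Sigma^\omega$ starting at $u$ is a sequence $(u_i)_{i\ge1}$ with $u_1=u$, $(u_{i+1},u_i)\in E$, $\lambda(u_i)=\alpha[i]$. $I_u$ is the set of strings with an occurrence starting at $u$, and $\min_u$ its lexicographic minimum. For $\alpha=a\alpha'\in\Sigma^\omega$ ($a\in\Sigma$): $\tau(\alpha)=1$ if $\alpha'\prec\alpha$, $=2$ if $\alpha'=\alpha$, $=3$ if $\alpha\prec\alpha'$; $\tau(u):=\tau(\min_u)$. For $u$ with $\tau(u)=3$, $\ell_u$ is the smallest $k\ge2$ with $\tau(u_k)\ge2$, where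 $(u_i)$ is any occurrence of $\min_u$ starting at $u$ (this does not depend on the occurrence). For nonempty $R\subseteq V$, let $R'=\arg\min_{v\in R}\lambda(v)$ and $\mathtt{F}(R)=\arg\min_{v\in R'}\tau(v)$. Define $G_1(u)=\{u\}$ and for $1<i\le\ell_u$, $G_i(u)=\mathtt{F}(\{v'\in V: \exists v\in G_{i-1}(u), (v',v)\in E\})\setminus\bigcup_{j=2}^{i-1}G_j(u)$. All nodes of $G_i(u)$ share the same $\tau$ value, denoted $\tau(G_i(u))$. Put $\gamma_u=\min_u[1,\ell_u]$ and $\mathtt{t}_u=\tau(G_{\ell_u}(u))\in\{2,3\}$. Let $\Sigma'=\{(\gamma_u,\mathtt{t}_u): u\in V,\tau(u)=3\}$ with the total order $\preceq'$ where for distinct $(\alpha,x),(\beta,y)$: $(\alpha,x)\prec'(\beta,y)$ iff either $\alpha$ is not a prefix of $\beta$ and $\alpha\prec\beta$; or $\alpha=\beta$, $x=2$, $y=3$; or $\beta$ is a strict prefix of $\alpha$. The derived graph $\bar G$ has nodes $\bar V=\{\bar u: u\in V,\tau(u)=3\}$, alphabet $(\Sigma',\preceq')$, labels $\lambda(\bar u)=(\gamma_u,\mathtt{t}_u)$ and edges $\bar E=\{(\bar v,\bar v):\mathtt{t}_v=2\}\cup\{(\bar u,\bar v):\mathtt{t}_v=3,\ u\in G_{\ell_v}(v)\}$; minima in $\bar G$ are taken w.r.t. the lexicographic extension of $\preceq'$ to $(\Sigma')^\omega$. *)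

theory Defs
  imports Main "HOL-Library.Sublist"
begin

text \<open>
  An edge-labelled graph together with its alphabet and an order on it. The order is a component
  of the graph (and not a type class instance), because the derived graph uses a different order on
  its own alphabet. Right-infinite strings and occurrences are functions on \<^typ>\<open>nat\<close>, so the
  \<open>i\<close>-th character of \<open>\<alpha>\<close> in one-based counting is \<open>\<alpha> (i - 1)\<close>.
\<close>

record ('v, 'a) ograph =
  nodes :: "'v set"
  alphabet :: "'a set"
  alph_le :: "'a rel"
  edges :: "('v \<times> 'v \<times> 'a) set"

locale standard_graph =
  fixes G :: "('v, 'a) ograph"
  assumes finite_nodes: "finite (nodes G)"
    and finite_alphabet: "finite (alphabet G)"
    and alphabet_order: "linear_order_on (alphabet G) (alph_le G)"
    and edges_wf: "edges G \<subseteq> nodes G \<times> nodes G \<times> alphabet G"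
    and alphabet_used: "a \<in> alphabet G \<Longrightarrow> \<exists>u v. (u, v, a) \<in> edges G"
    and incoming: "v \<in> nodes G \<Longrightarrow> \<exists>u a. (u, v, a) \<in> edges G"
    and input_consistent: "(u, v, a) \<in> edges G \<Longrightarrow> (u', v, a') \<in> edges G \<Longrightarrow> a = a'"
    and deterministic: "(u, v, a) \<in> edges G \<Longrightarrow> (u, v', a) \<in> edges G \<Longrightarrow> v = v'"

definition is_edge :: "('v, 'a) ograph \<Rightarrow> 'v \<Rightarrow> 'v \<Rightarrow> bool" where
  "is_edge G u v \<longleftrightarrow> (\<exists>a. (u, v, a) \<in> edges G)"

definition node_label :: "('v, 'a) ograph \<Rightarrow> 'v \<Rightarrow> 'a" where
  "node_label G u = (THE a. \<exists>v. (v, u, a) \<in> edges G)"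

definition lex_less :: "'a rel \<Rightarrow> (nat \<Rightarrow> 'a) \<Rightarrow> (nat \<Rightarrow> 'a) \<Rightarrow> bool" where
  "lex_less r \<alpha> \<beta> \<longleftrightarrow> (\<exists>n. (\<forall>i<n. \<alpha> i = \<beta> i) \<and> (\<alpha> n, \<beta> n) \<in> r - Id)"

definition str_less :: "('v, 'a) ograph \<Rightarrow> (nat \<Rightarrow> 'a) \<Rightarrow> (nat \<Rightarrow> 'a) \<Rightarrow> bool" where
  "str_less G = lex_less (alph_le G)"

definition occurrence :: "('v, 'a) ograph \<Rightarrow> (nat \<Rightarrow> 'a) \<Rightarrow> 'v \<Rightarrow> (nat \<Rightarrow> 'v) \<Rightarrow> bool" where
  "occurrence G \<alpha> u us \<longleftrightarrow>
     us 0 = u \<and> (\<forall>i. us i \<in> nodes G \<and> is_edge G (us (Suc i)) (us i) \<and> node_label G (us i) = \<alpha> i)"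

definition strings_of :: "('v, 'a) ograph \<Rightarrow> 'v \<Rightarrow> (nat \<Rightarrow> 'a) set" where
  "strings_of G u = {\<alpha>. \<exists>us. occurrence G \<alpha> u us}"

definition min_str :: "('v, 'a) ograph \<Rightarrow> 'v \<Rightarrow> nat \<Rightarrow> 'a" where
  "min_str G u =
     (THE \<alpha>. \<alpha> \<in> strings_of G u \<and> (\<forall>\<beta>\<in>strings_of G u. \<alpha> = \<beta> \<or> str_less G \<alpha> \<beta>))"

definition tau_str :: "('v, 'a) ograph \<Rightarrow> (nat \<Rightarrow> 'a) \<Rightarrow> nat" where
  "tau_str G \<alpha> =
     (let \<alpha>' = (\<lambda>i. \<alpha> (Suc i)) in
      if str_less G \<alpha>' \<alpha> then 1 else if \<alpha>' = \<alpha> then 2 else 3)"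

definition tau :: "('v, 'a) ograph \<Rightarrow> 'v \<Rightarrow> nat" where
  "tau G u = tau_str G (min_str G u)"

text \<open>
  The value below does not depend on the chosen occurrence. It is a one-based position:
  \<open>us (k - 1)\<close> is the \<open>k\<close>-th node of the occurrence.
\<close>

definition ell :: "('v, 'a) ograph \<Rightarrow> 'v \<Rightarrow> nat" where
  "ell G u =
     (let us = (SOME us. occurrence G (min_str G u) u us)
      in LEAST k. 2 \<le> k \<and> 2 \<le> tau G (us (k - 1)))"

definition label_argmin :: "('v, 'a) ograph \<Rightarrow> 'v set \<Rightarrow> 'v set" where
  "label_argmin G R = {v \<in> R. \<forall>w\<in>R. (node_label G v, node_label G w) \<in> alph_le G}"

definition tau_argmin :: "('v, 'a) ograph \<Rightarrow> 'v set \<Rightarrow> 'v set" where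
  "tau_argmin G R = {v \<in> R. \<forall>w\<in>R. tau G v \<le> tau G w}"

definition select :: "('v, 'a) ograph \<Rightarrow> 'v set \<Rightarrow> 'v set" where
  "select G R = tau_argmin G (label_argmin G R)"

text \<open>The index of \<open>layer\<close> is one-based; the value at index \<open>0\<close> is irrelevant.\<close>

fun layer :: "('v, 'a) ograph \<Rightarrow> 'v \<Rightarrow> nat \<Rightarrow> 'v set" where
  "layer G u i =
     (if i \<le> 1 then {u}
      else select G {v' \<in> nodes G. \<exists>v\<in>layer G u (i - 1). is_edge G v' v}
             - (\<Union>j\<in>{2..i - 1}. layer G u j))"

declare layer.simps [simp del]

definition gamma :: "('v, 'a) ograph \<Rightarrow> 'v \<Rightarrow> 'a list" where
  "gamma G u = map (min_str G u) [0..<ell G u]"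

definition end_tau :: "('v, 'a) ograph \<Rightarrow> 'v \<Rightarrow> nat" where
  "end_tau G u = the_elem (tau G ` layer G u (ell G u))"

definition derived_nodes :: "('v, 'a) ograph \<Rightarrow> 'v set" where
  "derived_nodes G = {u \<in> nodes G. tau G u = 3}"

definition derived_label :: "('v, 'a) ograph \<Rightarrow> 'v \<Rightarrow> 'a list \<times> nat" where
  "derived_label G u = (gamma G u, end_tau G u)"

definition derived_alphabet :: "('v, 'a) ograph \<Rightarrow> ('a list \<times> nat) set" where
  "derived_alphabet G = derived_label G ` derived_nodes G"

text \<open>
  Under \<^const>\<open>lexord\<close> a proper prefix is smaller than its extensions; in the derived order it is
  larger.
\<close>

definition derived_less :: "'a rel \<Rightarrow> 'a list \<times> nat \<Rightarrow> 'a list \<times> nat \<Rightarrow> bool" where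
  "derived_less r = (\<lambda>(\<alpha>, x) (\<beta>, y).
     (\<not> prefix \<alpha> \<beta> \<and> (\<alpha>, \<beta>) \<in> lexord (r - Id)) \<or>
     (\<alpha> = \<beta> \<and> x = 2 \<and> y = 3) \<or>
     strict_prefix \<beta> \<alpha>)"

definition derived_le :: "('v, 'a) ograph \<Rightarrow> ('a list \<times> nat) rel" where
  "derived_le G =
     {(p, q). p \<in> derived_alphabet G \<and> q \<in> derived_alphabet G \<and>
              (p = q \<or> derived_less (alph_le G) p q)}"

text \<open>The copy of a node \<open>u\<close> in the derived graph is represented by \<open>u\<close> itself.\<close>

definition derived :: "('v, 'a) ograph \<Rightarrow> ('v, 'a list \<times> nat) ograph" where
  "derived G =
     \<lparr> nodes = derived_nodes G,
       alphabet = derived_alphabet G,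
       alph_le = derived_le G,
       edges =
         {(v, v, derived_label G v) |v. v \<in> derived_nodes G \<and> end_tau G v = 2} \<union>
         {(u, v, derived_label G v) |u v. u \<in> derived_nodes G \<and> v \<in> derived_nodes G \<and>
            end_tau G v = 3 \<and> u \<in> layer G v (ell G v)} \<rparr>"

end

theory Submission
  imports Defs
begin

text \<open>
  Prepending \<open>v\<close> to a walk from a predecessor of \<open>v\<close> gives a walk from \<open>v\<close>, so
  \<open>tail 1 (min_str G v)\<close> is at most the minimal
  string of each predecessor, with equality along an occurrence of \<open>min_str G v\<close>. As the type is
  monotone among strings with a common first character, greedily minimizing label and type keeps the
  layers of \<open>u\<close> on nodes that look like the occurrences of \<open>min_str G u\<close>; the nodes removed from a
  layer never matter, because the tails of \<open>min_str G u\<close> decrease strictly until the last position.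
  Hence a derived label is determined by the minimal string and depends monotonically on it. The
  derived walk that always moves to the end of the factor on an occurrence of the minimal string
  therefore spells the minimal string of the derived graph, and this string determines
  \<open>min_str G u\<close>.
\<close>

section \<open>The lexicographic order on right-infinite strings\<close>

definition lex_le :: "'a rel \<Rightarrow> (nat \<Rightarrow> 'a) \<Rightarrow> (nat \<Rightarrow> 'a) \<Rightarrow> bool" where
  "lex_le r \<alpha> \<beta> \<longleftrightarrow> \<alpha> = \<beta> \<or> lex_less r \<alpha> \<beta>"

definition tail :: "nat \<Rightarrow> (nat \<Rightarrow> 'a) \<Rightarrow> nat \<Rightarrow> 'a" where
  "tail k \<alpha> = (\<lambda>i. \<alpha> (i + k))"

lemma tail_apply: "tail k \<alpha> i = \<alpha> (i + k)"
  by (simp add: tail_def)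

lemma tail_0 [simp]: "tail 0 \<alpha> = \<alpha>"
  by (simp add: tail_def)

lemma tail_tail [simp]: "tail k (tail l \<alpha>) = tail (k + l) \<alpha>"
  by (simp add: tail_def add.assoc)

lemma lex_less_irrefl [simp]: "\<not> lex_less r \<alpha> \<alpha>"
  by (simp add: lex_less_def)

lemma lex_le_refl [simp]: "lex_le r \<alpha> \<alpha>"
  by (simp add: lex_le_def)

lemma first_difference:
  assumes "\<alpha> \<noteq> (\<beta> :: nat \<Rightarrow> 'a)"
  obtains n where "\<And>i. i < n \<Longrightarrow> \<alpha> i = \<beta> i" "\<alpha> n \<noteq> \<beta> n"
proof -
  from assms obtain m where "\<alpha> m \<noteq> \<beta> m" by auto
  then show thesis
    using that[of "LEAST n. \<alpha> n \<noteq> \<beta> n"] not_less_Least LeastI[of "\<lambda>n. \<alpha> n \<noteq> \<beta> n" m] by blast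
qed

lemma lex_less_asym:
  assumes "antisym r" "lex_less r \<alpha> \<beta>"
  shows "\<not> lex_less r \<beta> \<alpha>"
proof
  assume "lex_less r \<beta> \<alpha>"
  then obtain m where m: "\<forall>i<m. \<beta> i = \<alpha> i" "(\<beta> m, \<alpha> m) \<in> r - Id"
    unfolding lex_less_def by blast
  from assms(2) obtain n where n: "\<forall>i<n. \<alpha> i = \<beta> i" "(\<alpha> n, \<beta> n) \<in> r - Id"
    unfolding lex_less_def by blast
  show False
    using m n assms(1) by (cases m n rule: linorder_cases) (auto dest: antisymD)
qed

lemma lex_less_trans:
  assumes "trans r" "antisym r" "lex_less r \<alpha> \<beta>" "lex_less r \<beta> \<delta>"
  shows "lex_less r \<alpha> \<delta>"
proof -
  from assms(3) obtain n where n: "\<forall>i<n. \<alpha> i = \<beta> i" "(\<alpha> n, \<beta> n) \<in> r - Id"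
    unfolding lex_less_def by blast
  from assms(4) obtain m where m: "\<forall>i<m. \<beta> i = \<delta> i" "(\<beta> m, \<delta> m) \<in> r - Id"
    unfolding lex_less_def by blast
  \<comment> \<open>The earlier of the two first differences decides; when they coincide,
    antisymmetry keeps the composed inequality strict.\<close>
  have "(\<alpha> (min n m), \<delta> (min n m)) \<in> r - Id"
  proof (cases m n rule: linorder_cases)
    case less
    then show ?thesis using n(1) m(2) by (simp add: min_def)
  next
    case equal
    then have "(\<alpha> n, \<beta> n) \<in> r - Id" "(\<beta> n, \<delta> n) \<in> r - Id" using n m by auto
    then have "(\<alpha> n, \<delta> n) \<in> r - Id"
      by (rule transD[OF trans_diff_Id[OF assms(1,2)]])
    then show ?thesis using equal by simp
  next
    case greater
    then show ?thesis using n(2) m(1) by (simp add: min_def)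
  qed
  moreover have "\<forall>i<min n m. \<alpha> i = \<delta> i"
    using n m by auto
  ultimately show ?thesis
    unfolding lex_less_def by blast
qed

lemma lex_le_less_trans:
  assumes "trans r" "antisym r" "lex_le r \<alpha> \<beta>" "lex_less r \<beta> \<delta>"
  shows "lex_less r \<alpha> \<delta>"
  using assms lex_less_trans unfolding lex_le_def by blast

lemma lex_le_trans:
  assumes "trans r" "antisym r" "lex_le r \<alpha> \<beta>" "lex_le r \<beta> \<delta>"
  shows "lex_le r \<alpha> \<delta>"
  using assms lex_less_trans unfolding lex_le_def by blast

lemma lex_le_antisym:
  assumes "antisym r" "lex_le r \<alpha> \<beta>" "lex_le r \<beta> \<alpha>"
  shows "\<alpha> = \<beta>"
  using assms lex_less_asym unfolding lex_le_def by blast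

text \<open>The first difference cannot lie in the common prefix, so dropping that prefix only
  shifts it by \<open>k\<close>.\<close>

lemma lex_less_tail:
  assumes "\<And>i. i < k \<Longrightarrow> \<alpha> i = \<beta> i"
  shows "lex_less r (tail k \<alpha>) (tail k \<beta>) \<longleftrightarrow> lex_less r \<alpha> \<beta>"
proof
  assume "lex_less r (tail k \<alpha>) (tail k \<beta>)"
  then obtain n where n: "\<forall>i<n. \<alpha> (i + k) = \<beta> (i + k)" "(\<alpha> (n + k), \<beta> (n + k)) \<in> r - Id"
    unfolding lex_less_def tail_apply by auto
  have "\<alpha> i = \<beta> i" if "i < n + k" for i
    using n(1)[rule_format, of "i - k"] assms[of i] that by (cases "i < k") auto
  then show "lex_less r \<alpha> \<beta>"
    unfolding lex_less_def using n(2) by blast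
next
  assume "lex_less r \<alpha> \<beta>"
  then obtain n where n: "\<forall>i<n. \<alpha> i = \<beta> i" "(\<alpha> n, \<beta> n) \<in> r - Id"
    unfolding lex_less_def by auto
  then have "k \<le> n" using assms[of n] by (cases "n < k") auto
  then show "lex_less r (tail k \<alpha>) (tail k \<beta>)"
    unfolding lex_less_def using n by (intro exI[of _ "n - k"]) (auto simp: tail_apply)
qed

lemma lex_le_tail:
  assumes "\<And>i. i < k \<Longrightarrow> \<alpha> i = \<beta> i" "lex_le r \<alpha> \<beta>"
  shows "lex_le r (tail k \<alpha>) (tail k \<beta>)"
proof -
  have "lex_less r (tail k \<alpha>) (tail k \<beta>) \<longleftrightarrow> lex_less r \<alpha> \<beta>"
    using assms(1) by (rule lex_less_tail)
  then show ?thesis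
    using assms(2) unfolding lex_le_def by auto
qed

lemma lex_le_head:
  assumes "lex_le r \<alpha> \<beta>"
  shows "\<alpha> 0 = \<beta> 0 \<or> (\<alpha> 0, \<beta> 0) \<in> r"
proof (cases "\<alpha> = \<beta>")
  case False
  then obtain n where "\<forall>i<n. \<alpha> i = \<beta> i" "(\<alpha> n, \<beta> n) \<in> r - Id"
    using assms unfolding lex_le_def lex_less_def by blast
  then show ?thesis by (cases n) auto
qed simp

text \<open>Lets strings be compared by following two walks: agreement so far keeps an invariant
  alive, and the invariant bounds the next character.\<close>

lemma lex_leI_first_difference:
  assumes "\<And>n. (\<And>i. i < n \<Longrightarrow> \<alpha> i = \<beta> i) \<Longrightarrow> \<alpha> n = \<beta> n \<or> (\<alpha> n, \<beta> n) \<in> r"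
  shows "lex_le r \<alpha> \<beta>"
proof (cases "\<alpha> = \<beta>")
  case False
  then obtain n where "\<And>i. i < n \<Longrightarrow> \<alpha> i = \<beta> i" "\<alpha> n \<noteq> \<beta> n"
    using first_difference[of \<alpha> \<beta>] by metis
  then show ?thesis
    using assms[of n] unfolding lex_le_def lex_less_def by blast
qed simp

section \<open>Minimal strings\<close>

context standard_graph
begin

lemma trans_alph: "trans (alph_le G)" and antisym_alph: "antisym (alph_le G)"
  and total_alph: "total_on (alphabet G) (alph_le G)" and refl_alph: "refl_on (alphabet G) (alph_le G)"
  using alphabet_order unfolding order_on_defs by simp_all

abbreviation str_le :: "(nat \<Rightarrow> 'a) \<Rightarrow> (nat \<Rightarrow> 'a) \<Rightarrow> bool" where
  "str_le \<equiv> lex_le (alph_le G)"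

lemma is_edgeD:
  assumes "is_edge G v' v"
  shows "v' \<in> nodes G" "v \<in> nodes G"
  using assms edges_wf unfolding is_edge_def by auto

lemma node_label_eq: "(v', v, a) \<in> edges G \<Longrightarrow> node_label G v = a"
  unfolding node_label_def using input_consistent by blast

lemma node_label_alphabet: "v \<in> nodes G \<Longrightarrow> node_label G v \<in> alphabet G"
  using incoming[of v] node_label_eq edges_wf by blast

lemma ex_is_edge: "v \<in> nodes G \<Longrightarrow> \<exists>v'. is_edge G v' v"
  using incoming unfolding is_edge_def by blast

lemma occurrence_tail: "occurrence G \<alpha> u us \<Longrightarrow> occurrence G (tail k \<alpha>) (us k) (tail k us)"
  unfolding occurrence_def by (simp add: tail_apply)

lemma occurrence_Cons:
  assumes "occurrence G \<alpha> v' us" "is_edge G v' v"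
  shows "occurrence G (case_nat (node_label G v) \<alpha>) v (case_nat v us)"
  using assms is_edgeD[OF assms(2)] unfolding occurrence_def by (auto split: nat.split)

section \<open>Existence of minimal strings by greedy choice and compactness\<close>

definition preds :: "'v set \<Rightarrow> 'v set" where
  "preds R = {v' \<in> nodes G. \<exists>v\<in>R. is_edge G v' v}"

lemma label_argmin_nonempty:
  assumes "R \<subseteq> nodes G" "R \<noteq> {}"
  shows "label_argmin G R \<noteq> {}"
proof -
  have "finite R" using assms(1) finite_nodes finite_subset by blast
  then show ?thesis
    using assms(2,1)
  proof (induction R rule: finite_ne_induct)
    case (singleton x)
    then show ?case
      using node_label_alphabet refl_alph unfolding label_argmin_def refl_on_def by auto
  next
    case (insert x F)
    then obtain y where y: "y \<in> F" "\<forall>w\<in>F. (node_label G y, node_label G w) \<in> alph_le G"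
      unfolding label_argmin_def by auto
    have xy: "node_label G x \<in> alphabet G" "node_label G y \<in> alphabet G"
      using y insert.prems node_label_alphabet by auto
    then consider "(node_label G x, node_label G y) \<in> alph_le G"
      | "(node_label G y, node_label G x) \<in> alph_le G"
      using total_alph refl_alph unfolding total_on_def refl_on_def by metis
    then show ?case
    proof cases
      case 1
      then have "x \<in> label_argmin G (insert x F)"
        using y xy refl_alph trans_alph unfolding label_argmin_def refl_on_def by (auto dest: transD)
      then show ?thesis by blast
    next
      case 2
      then have "y \<in> label_argmin G (insert x F)"
        using y unfolding label_argmin_def by auto
      then show ?thesis by blast
    qed
  qed
qed

text \<open>Greedy candidates for position \<open>n\<close> of a minimal walk, using labels only.
  The sets \<open>layer\<close> cannot serve here: they consult \<open>tau\<close>, hence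
  \<open>min_str\<close>, whose existence is still to be shown.\<close>

fun front :: "'v \<Rightarrow> nat \<Rightarrow> 'v set" where
  "front u 0 = {u}"
| "front u (Suc n) = label_argmin G (preds (front u n))"

lemma front_subset: "u \<in> nodes G \<Longrightarrow> front u n \<subseteq> nodes G"
  by (cases n) (auto simp: label_argmin_def preds_def)

lemma front_nonempty: "u \<in> nodes G \<Longrightarrow> front u n \<noteq> {}"
proof (induction n)
  case (Suc n)
  then obtain v where "v \<in> front u n" by blast
  then have "preds (front u n) \<noteq> {}"
    using ex_is_edge is_edgeD front_subset[OF Suc.prems] unfolding preds_def by blast
  then show ?case
    using label_argmin_nonempty by (simp add: preds_def)
qed simp

lemma front_label_le:
  "v \<in> front u (Suc n) \<Longrightarrow> w \<in> preds (front u n) \<Longrightarrow> (node_label G v, node_label G w) \<in> alph_le G"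
  by (simp add: label_argmin_def)

lemma front_finite_walk:
  "v \<in> front u n \<Longrightarrow>
    \<exists>ws. ws 0 = u \<and> ws n = v \<and> (\<forall>i\<le>n. ws i \<in> front u i) \<and> (\<forall>i<n. is_edge G (ws (Suc i)) (ws i))"
proof (induction n arbitrary: v)
  case 0
  then show ?case by (intro exI[of _ "\<lambda>_. u"]) simp
next
  case (Suc n)
  then obtain w where w: "w \<in> front u n" "is_edge G v w"
    by (auto simp: label_argmin_def preds_def)
  with Suc.IH obtain ws where "ws 0 = u" "ws n = w" "\<forall>i\<le>n. ws i \<in> front u i"
    "\<forall>i<n. is_edge G (ws (Suc i)) (ws i)" by blast
  then show ?case
    using w Suc.prems by (intro exI[of _ "ws(Suc n := v)"]) (auto simp: le_Suc_eq less_Suc_eq)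
qed

text \<open>Koenig's lemma: \<open>good n v\<close> says that \<open>v\<close> starts arbitrarily long walks through the fronts from
  \<open>n\<close> onwards.\<close>

lemma front_infinite_walk:
  assumes u: "u \<in> nodes G"
  obtains us where "us 0 = u" "\<And>i. us i \<in> front u i" "\<And>i. is_edge G (us (Suc i)) (us i)"
proof -
  define good where "good n v \<longleftrightarrow> (\<forall>m. \<exists>ws. ws 0 = v \<and> (\<forall>i\<le>m. ws i \<in> front u (n + i)) \<and>
      (\<forall>i<m. is_edge G (ws (Suc i)) (ws i)))" for n v
  have good_0: "good 0 u"
    unfolding good_def
  proof
    fix m
    obtain v where "v \<in> front u m" using front_nonempty[OF u] by blast
    from front_finite_walk[OF this]
    show "\<exists>ws. ws 0 = u \<and> (\<forall>i\<le>m. ws i \<in> front u (0 + i)) \<and> (\<forall>i<m. is_edge G (ws (Suc i)) (ws i))"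
      by auto
  qed
  have good_Suc: "\<exists>v'. good (Suc n) v' \<and> is_edge G v' v" if "good n v" for n v
  proof (rule ccontr)
    assume none: "\<not> ?thesis"
    let ?W = "\<lambda>v' m ws. ws 0 = v' \<and> (\<forall>i\<le>m. ws i \<in> front u (Suc n + i)) \<and>
      (\<forall>i<m. is_edge G (ws (Suc i)) (ws i))"
    have "\<exists>m. \<nexists>ws. ?W v' m ws" if "is_edge G v' v" for v'
    proof -
      have "\<not> good (Suc n) v'" using none that by blast
      then show ?thesis unfolding good_def by simp
    qed
    then have "\<forall>v'\<in>{v'. is_edge G v' v}. \<exists>m. \<nexists>ws. ?W v' m ws" by simp
    then obtain b where b: "\<And>v'. is_edge G v' v \<Longrightarrow> \<nexists>ws. ?W v' (b v') ws"
      unfolding bchoice_iff by auto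
    \<comment> \<open>One length \<open>M\<close> serves all predecessors because there are finitely
      many nodes. The values of \<open>b\<close> outside the predecessors are arbitrary but can only
      enlarge \<open>M\<close>.\<close>
    define M where "M = Max (b ` nodes G)"
    from \<open>good n v\<close> obtain ws where "ws 0 = v \<and> (\<forall>i\<le>Suc M. ws i \<in> front u (n + i)) \<and>
        (\<forall>i<Suc M. is_edge G (ws (Suc i)) (ws i))"
      unfolding good_def by blast
    then have ws: "ws 0 = v" "\<And>i. i \<le> Suc M \<Longrightarrow> ws i \<in> front u (n + i)"
      "\<And>i. i < Suc M \<Longrightarrow> is_edge G (ws (Suc i)) (ws i)"
      by auto
    have e: "is_edge G (ws 1) v" using ws(3)[of 0] ws(1) by simp
    then have "b (ws 1) \<le> M"
      unfolding M_def using is_edgeD finite_nodes by simp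
    \<comment> \<open>Dropping \<open>v\<close> from its walk of length \<open>Suc M\<close> leaves
      one of length \<open>M\<close>, long enough to contradict the choice of
      \<open>b (ws 1)\<close>.\<close>
    then have W: "?W (ws 1) (b (ws 1)) (\<lambda>i. ws (Suc i))"
      using ws(2)[of "Suc _"] ws(3)[of "Suc _"] by auto
    from exI[of "?W (ws 1) (b (ws 1))", OF W] b[OF e] show False by (rule notE[rotated])
  qed
  have "\<exists>us. \<forall>n. (good n (us n) \<and> (n = 0 \<longrightarrow> us n = u)) \<and> is_edge G (us (Suc n)) (us n)"
  proof (rule dependent_nat_choice)
    show "\<exists>v. good 0 v \<and> ((0::nat) = 0 \<longrightarrow> v = u)"
      using good_0 by blast
  next
    fix v n
    assume "good n v \<and> (n = 0 \<longrightarrow> v = u)"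
    then show "\<exists>v'. (good (Suc n) v' \<and> (Suc n = 0 \<longrightarrow> v' = u)) \<and> is_edge G v' v"
      using good_Suc[of n v] by auto
  qed
  then obtain us where us: "\<And>n. good n (us n)" "us 0 = u" "\<And>n. is_edge G (us (Suc n)) (us n)"
    by auto
  show thesis
  proof (rule that[of us])
    show "us i \<in> front u i" for i
      using us(1)[of i, unfolded good_def, rule_format, of 0] by auto
  qed (use us in auto)
qed

text \<open>The labels along an infinite walk through the fronts form the minimum: a competitor that
  has agreed so far is itself still in the fronts, so its next node was among the candidates when
  the next label was minimized.\<close>

lemma ex_min_string:
  assumes "u \<in> nodes G"
  shows "\<exists>\<alpha>\<in>strings_of G u. \<forall>\<beta>\<in>strings_of G u. str_le \<alpha> \<beta>"
proof -
  obtain us where us: "us 0 = u" "\<And>i. us i \<in> front u i" "\<And>i. is_edge G (us (Suc i)) (us i)"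
    using front_infinite_walk[OF assms] by metis
  define \<alpha> where "\<alpha> i = node_label G (us i)" for i
  have "occurrence G \<alpha> u us"
    using us is_edgeD unfolding occurrence_def \<alpha>_def by blast
  moreover have "str_le \<alpha> \<beta>" if "\<beta> \<in> strings_of G u" for \<beta>
  proof (rule lex_leI_first_difference)
    fix n
    assume eq: "\<And>i. i < n \<Longrightarrow> \<alpha> i = \<beta> i"
    from that obtain vs where vs: "vs 0 = u" "\<And>i. vs i \<in> nodes G"
      "\<And>i. is_edge G (vs (Suc i)) (vs i)" "\<And>i. node_label G (vs i) = \<beta> i"
      unfolding strings_of_def occurrence_def by blast
    have step: "vs (Suc i) \<in> preds (front u i)" if "vs i \<in> front u i" for i
      using that vs unfolding preds_def by blast
    have front: "i < n \<Longrightarrow> vs i \<in> front u i" for i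
    proof (induction i)
      case (Suc i)
      then have "vs (Suc i) \<in> preds (front u i)" using step by simp
      moreover have "node_label G (vs (Suc i)) = node_label G (us (Suc i))"
        using eq[OF Suc.prems] vs unfolding \<alpha>_def by simp
      ultimately show ?case
        using us(2)[of "Suc i"] by (simp add: label_argmin_def)
    qed (simp add: vs)
    show "\<alpha> n = \<beta> n \<or> (\<alpha> n, \<beta> n) \<in> alph_le G"
    proof (cases n)
      case 0
      then show ?thesis using us vs unfolding \<alpha>_def by metis
    next
      case (Suc m)
      then show ?thesis
        using front_label_le[OF us(2)] step[OF front] vs unfolding \<alpha>_def by (metis lessI)
    qed
  qed
  ultimately show ?thesis unfolding strings_of_def by blast
qed

section \<open>Minimal strings along edges and occurrences\<close>

lemma min_str_props:
  assumes "u \<in> nodes G"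
  shows min_str_in: "min_str G u \<in> strings_of G u"
    and min_str_le: "\<beta> \<in> strings_of G u \<Longrightarrow> str_le (min_str G u) \<beta>"
proof -
  let ?P = "\<lambda>\<alpha>. \<alpha> \<in> strings_of G u \<and> (\<forall>\<beta>\<in>strings_of G u. \<alpha> = \<beta> \<or> str_less G \<alpha> \<beta>)"
  from ex_min_string[OF assms] obtain \<alpha> where \<alpha>: "?P \<alpha>"
    unfolding lex_le_def str_less_def by blast
  have "\<alpha>' = \<alpha>" if "?P \<alpha>'" for \<alpha>'
  proof -
    have "\<alpha>' = \<alpha> \<or> str_less G \<alpha>' \<alpha>" "\<alpha> = \<alpha>' \<or> str_less G \<alpha> \<alpha>'"
      using that \<alpha> by simp_all
    then show ?thesis
      using lex_less_asym[OF antisym_alph, of \<alpha> \<alpha>'] unfolding str_less_def by auto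
  qed
  with \<alpha> have "?P (min_str G u)"
    unfolding min_str_def by (rule theI)
  then show "min_str G u \<in> strings_of G u"
    "\<beta> \<in> strings_of G u \<Longrightarrow> str_le (min_str G u) \<beta>"
    unfolding lex_le_def str_less_def by auto
qed

lemma min_str_occurrence:
  assumes "u \<in> nodes G"
  obtains us where "occurrence G (min_str G u) u us"
  using min_str_in[OF assms] unfolding strings_of_def by blast

lemma min_str_0: "u \<in> nodes G \<Longrightarrow> min_str G u 0 = node_label G u"
  by (metis min_str_occurrence occurrence_def)

text \<open>Prepending \<open>v\<close> to an occurrence of \<open>min_str G v'\<close> gives a
  competitor for \<open>min_str G v\<close> with the same first character, which can be
  cancelled.\<close>

lemma min_str_edge:
  assumes "is_edge G v' v"
  shows "str_le (tail 1 (min_str G v)) (min_str G v')"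
proof -
  note nodes = is_edgeD[OF assms]
  obtain us where "occurrence G (min_str G v') v' us"
    using min_str_occurrence[OF nodes(1)] .
  from occurrence_Cons[OF this assms]
  have "str_le (min_str G v) (case_nat (node_label G v) (min_str G v'))"
    using min_str_le[OF nodes(2)] unfolding strings_of_def by blast
  then have "str_le (tail 1 (min_str G v)) (tail 1 (case_nat (node_label G v) (min_str G v')))"
    by (rule lex_le_tail[rotated]) (simp add: min_str_0 nodes)
  moreover have "tail 1 (case_nat (node_label G v) (min_str G v')) = min_str G v'"
    by (simp add: tail_def)
  ultimately show ?thesis by simp
qed

text \<open>The tail of the occurrence bounds \<open>min_str G (us k)\<close> from above, the edge
  inequality bounds it from below. Hence the types along an occurrence depend on the string
  alone.\<close>

lemma min_str_along:
  assumes occ: "occurrence G (min_str G u) u us"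
  shows "min_str G (us k) = tail k (min_str G u)"
proof (induction k)
  case 0
  then show ?case using occ by (simp add: occurrence_def)
next
  case (Suc k)
  have e: "is_edge G (us (Suc k)) (us k)" using occ by (simp add: occurrence_def)
  have "str_le (min_str G (us (Suc k))) (tail (Suc k) (min_str G u))"
    using min_str_le is_edgeD[OF e] occurrence_tail[OF occ] unfolding strings_of_def by blast
  moreover have "str_le (tail (Suc k) (min_str G u)) (min_str G (us (Suc k)))"
    using min_str_edge[OF e] unfolding Suc tail_tail by simp
  ultimately show ?case by (rule lex_le_antisym[OF antisym_alph])
qed

section \<open>Types of strings\<close>

lemma tau_str_tail:
  "tau_str G \<alpha> = (if lex_less (alph_le G) (tail 1 \<alpha>) \<alpha> then 1 else if tail 1 \<alpha> = \<alpha> then 2 else 3)"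
  by (simp add: tau_str_def str_less_def tail_def Let_def)

lemma tau_str_bounds: "1 \<le> tau_str G \<alpha>" "tau_str G \<alpha> \<le> 3"
  by (auto simp: tau_str_tail)

lemma const_prefix_iff: "(\<forall>i<k. \<alpha> (Suc i) = \<alpha> i) \<longleftrightarrow> (\<forall>i\<le>k. \<alpha> i = (\<alpha> 0 :: 'b))"
proof (induction k)
  case (Suc k)
  then show ?case
    unfolding less_Suc_eq le_Suc_eq by (metis order_refl)
qed simp

text \<open>Comparing a string with its own shift locates the end of the initial run of its first
  character: type 1 means that this run ends with a descent.\<close>

lemma tau_str_1_iff:
  "tau_str G \<alpha> = 1 \<longleftrightarrow> (\<exists>k. (\<forall>i\<le>k. \<alpha> i = \<alpha> 0) \<and> (\<alpha> (Suc k), \<alpha> 0) \<in> alph_le G - Id)"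
proof -
  have "tau_str G \<alpha> = 1 \<longleftrightarrow> (\<exists>k. (\<forall>i<k. \<alpha> (Suc i) = \<alpha> i) \<and> (\<alpha> (Suc k), \<alpha> k) \<in> alph_le G - Id)"
    by (simp add: tau_str_tail lex_less_def tail_apply)
  also have "\<dots> \<longleftrightarrow> (\<exists>k. (\<forall>i\<le>k. \<alpha> i = \<alpha> 0) \<and> (\<alpha> (Suc k), \<alpha> 0) \<in> alph_le G - Id)"
  proof (rule iff_exI)
    fix k
    have "(\<forall>i<k. \<alpha> (Suc i) = \<alpha> i) \<longleftrightarrow> (\<forall>i\<le>k. \<alpha> i = \<alpha> 0)"
      by (simp add: const_prefix_iff)
    then show "(\<forall>i<k. \<alpha> (Suc i) = \<alpha> i) \<and> (\<alpha> (Suc k), \<alpha> k) \<in> alph_le G - Id \<longleftrightarrow>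
        (\<forall>i\<le>k. \<alpha> i = \<alpha> 0) \<and> (\<alpha> (Suc k), \<alpha> 0) \<in> alph_le G - Id"
      by (metis order_refl)
  qed
  finally show ?thesis .
qed

text \<open>If \<open>\<beta>\<close> has type 1, then either \<open>\<alpha>\<close> shares its
  initial run and the descent, or \<open>\<alpha>\<close> falls below its first character already at
  the first difference. The latter also happens when \<open>\<beta>\<close> is constant. Type 3 is
  the maximum.\<close>

lemma tau_str_mono:
  assumes "str_le \<alpha> \<beta>" "\<alpha> 0 = \<beta> 0"
  shows "tau_str G \<alpha> \<le> tau_str G \<beta>"
proof (cases "\<alpha> = \<beta>")
  case False
  then obtain n where n: "\<And>i. i < n \<Longrightarrow> \<alpha> i = \<beta> i" "(\<alpha> n, \<beta> n) \<in> alph_le G - Id"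
    using assms(1) unfolding lex_le_def lex_less_def by blast
  \<comment> \<open>The first difference is not at index 0, so \<open>m\<close> below is the last
    index of the common prefix.\<close>
  with assms(2) have "n > 0" by (metis DiffE IdI gr0I)
  then obtain m where m: "n = Suc m" by (cases n) auto
  have strict: "tau_str G \<alpha> = 1" if "\<And>i. i \<le> m \<Longrightarrow> \<beta> i = \<beta> 0"
    "\<beta> n = \<beta> 0 \<or> (\<beta> n, \<beta> 0) \<in> alph_le G"
  proof -
    have "(\<alpha> n, \<beta> 0) \<in> alph_le G - Id"
      using that(2)
    proof
      assume "\<beta> n = \<beta> 0"
      then show ?thesis using n(2) by simp
    next
      assume "(\<beta> n, \<beta> 0) \<in> alph_le G"
      then show ?thesis
        using n(2) transD[OF trans_alph, of "\<alpha> n" "\<beta> n" "\<beta> 0"]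
          antisymD[OF antisym_alph, of "\<alpha> n" "\<beta> n"] by auto
    qed
    moreover have "\<alpha> i = \<alpha> 0" if "i \<le> m" for i
      using n(1)[of i] \<open>\<And>i. i \<le> m \<Longrightarrow> \<beta> i = \<beta> 0\<close>[OF that] that m assms(2) by simp
    ultimately show ?thesis
      unfolding tau_str_1_iff using m assms(2) by (intro exI[of _ m]) auto
  qed
  consider "tau_str G \<beta> = 1" | "tau_str G \<beta> = 2" | "tau_str G \<beta> = 3"
    using tau_str_bounds[of \<beta>] by linarith
  then show ?thesis
  proof cases
    case 1
    then obtain k where k: "\<forall>i\<le>k. \<beta> i = \<beta> 0" "(\<beta> (Suc k), \<beta> 0) \<in> alph_le G - Id"
      unfolding tau_str_1_iff by blast
    have "tau_str G \<alpha> = 1"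
    proof (cases "m \<le> k")
      case True
      then show ?thesis
      proof (intro strict)
        show "\<beta> i = \<beta> 0" if "i \<le> m" for i
          using k(1) that True by (blast intro: le_trans)
        show "\<beta> n = \<beta> 0 \<or> (\<beta> n, \<beta> 0) \<in> alph_le G"
        proof (cases "m = k")
          case False
          with True m have "n \<le> k" by simp
          with k(1) show ?thesis by blast
        qed (use k(2) m in blast)
      qed
    next
      case False
      then have eq: "\<alpha> i = \<beta> i" if "i \<le> Suc k" for i using n(1) m that by simp
      have "\<alpha> i = \<alpha> 0" if "i \<le> k" for i
        using eq[of i] eq[of 0] that k(1)[rule_format, of i] by simp
      moreover have "(\<alpha> (Suc k), \<alpha> 0) \<in> alph_le G - Id"
        using eq[of "Suc k"] eq[of 0] k(2) by simp
      ultimately show ?thesis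
        unfolding tau_str_1_iff by blast
    qed
    then show ?thesis using 1 by simp
  next
    case 2
    then have "tail 1 \<beta> = \<beta>" by (auto simp: tau_str_tail split: if_splits)
    then have "\<beta> (Suc i) = \<beta> i" for i by (metis Suc_eq_plus1 tail_apply)
    then have "\<beta> i = \<beta> 0" for i by (induction i) auto
    then have "tau_str G \<alpha> = 1" using strict by blast
    then show ?thesis using 2 by simp
  next
    case 3
    then show ?thesis using tau_str_bounds by simp
  qed
qed simp

lemma tau_along:
  "occurrence G (min_str G u) u us \<Longrightarrow> tau G (us k) = tau_str G (tail k (min_str G u))"
  by (simp add: tau_def min_str_along)

section \<open>Layers\<close>

text \<open>Zero-based index of the last character of \<open>gamma G u\<close>: an occurrence
  \<open>us\<close> has its \<open>ell\<close>-th node at \<open>us (jump u)\<close>.\<close>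

definition jump :: "'v \<Rightarrow> nat" where
  "jump u = ell G u - 1"

text \<open>The types along an occurrence are those of the tails of \<open>min_str G u\<close>, so
  the occurrence picked by \<open>SOME\<close> does not matter.\<close>

lemma ell_eq:
  assumes "u \<in> nodes G"
  shows "ell G u = (LEAST k. 2 \<le> k \<and> 2 \<le> tau_str G (tail (k - 1) (min_str G u)))"
proof -
  define us where "us = (SOME us. occurrence G (min_str G u) u us)"
  have "occurrence G (min_str G u) u us"
    unfolding us_def using min_str_occurrence[OF assms] by (metis someI_ex)
  then show ?thesis
    unfolding ell_def us_def[symmetric] Let_def by (simp add: tau_along)
qed

lemma lex_less_tails:
  assumes "\<And>m. k \<le> m \<Longrightarrow> m < n \<Longrightarrow> tau_str G (tail m \<alpha>) = 1" "k < n"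
  shows "lex_less (alph_le G) (tail n \<alpha>) (tail k \<alpha>)"
  using assms
proof (induction n)
  case (Suc n)
  have "tau_str G (tail n \<alpha>) = 1" using Suc.prems by simp
  then have "lex_less (alph_le G) (tail (Suc n) \<alpha>) (tail n \<alpha>)"
    by (simp add: tau_str_tail split: if_splits)
  moreover have "str_le (tail n \<alpha>) (tail k \<alpha>)"
    using Suc unfolding lex_le_def by (cases "n = k") simp_all
  ultimately show ?case
    using lex_less_trans[OF trans_alph antisym_alph] unfolding lex_le_def by metis
qed simp

text \<open>If every later tail had type 1, the tails would decrease strictly forever; but an
  occurrence in a finite graph revisits a node, and equal nodes carry equal tails.\<close>

lemma ex_tau_ge_2:
  assumes "u \<in> nodes G"
  shows "\<exists>k\<ge>1. 2 \<le> tau_str G (tail k (min_str G u))"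
proof (rule ccontr)
  let ?\<alpha> = "min_str G u"
  assume "\<not> ?thesis"
  then have tau_1: "tau_str G (tail m ?\<alpha>) = 1" if "1 \<le> m" for m
    using that tau_str_bounds(1)[of "tail m ?\<alpha>"] by fastforce
  obtain us where occ: "occurrence G ?\<alpha> u us" using min_str_occurrence[OF assms] .
  then have "us ` {1..} \<subseteq> nodes G" unfolding occurrence_def by auto
  then have "finite (us ` {1..})" using finite_nodes finite_subset by blast
  then have "\<not> inj_on us {1..}" using finite_imageD infinite_Ici by blast
  then obtain k m where km: "1 \<le> k" "k < m" "us k = us m"
    unfolding inj_on_def by (metis atLeast_iff linorder_neqE_nat)
  then have "lex_less (alph_le G) (tail m ?\<alpha>) (tail k ?\<alpha>)"
    using tau_1 by (intro lex_less_tails) simp_all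
  moreover have "tail m ?\<alpha> = tail k ?\<alpha>"
    using min_str_along[OF occ] km(3) by metis
  ultimately show False by simp
qed

lemma jump_props:
  assumes "u \<in> nodes G"
  shows ell_jump: "ell G u = Suc (jump u)"
    and jump_ge_1: "1 \<le> jump u"
    and tau_jump: "2 \<le> tau_str G (tail (jump u) (min_str G u))"
    and tau_before_jump: "1 \<le> k \<Longrightarrow> k < jump u \<Longrightarrow> tau_str G (tail k (min_str G u)) = 1"
proof -
  let ?P = "\<lambda>k. 2 \<le> k \<and> 2 \<le> tau_str G (tail (k - 1) (min_str G u))"
  obtain k0 where "1 \<le> k0" "2 \<le> tau_str G (tail k0 (min_str G u))"
    using ex_tau_ge_2[OF assms] by blast
  then have "?P (Suc k0)" by simp
  then have ell: "?P (ell G u)" unfolding ell_eq[OF assms] by (rule LeastI)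
  then show "ell G u = Suc (jump u)" "1 \<le> jump u" "2 \<le> tau_str G (tail (jump u) (min_str G u))"
    unfolding jump_def by auto
  assume k: "1 \<le> k" "k < jump u"
  then have "\<not> ?P (Suc k)"
    using not_less_Least[of "Suc k" ?P] unfolding ell_eq[OF assms, symmetric] jump_def by simp
  with k(1) show "tau_str G (tail k (min_str G u)) = 1"
    using tau_str_bounds(1)[of "tail k (min_str G u)"] by simp
qed

lemma layer_1: "layer G u (Suc 0) = {u}"
  by (simp add: layer.simps)

lemma layer_Suc:
  "layer G u (Suc (Suc k)) = select G (preds (layer G u (Suc k))) - (\<Union>j\<in>{2..Suc k}. layer G u j)"
  by (subst layer.simps) (simp add: preds_def)

text \<open>The inequality with \<open>min_str G v\<close> is the part of the invariant that passes
  to predecessors; labels and types follow from it because \<open>us k\<close> attains both bounds.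
  The induction is strong since the removal refers to all earlier layers.\<close>

lemma layer_props:
  assumes "u \<in> nodes G" and occ: "occurrence G (min_str G u) u us" and "k \<le> jump u"
  shows "us k \<in> layer G u (Suc k) \<and> (\<forall>v\<in>layer G u (Suc k). v \<in> nodes G \<and>
    node_label G v = min_str G u k \<and> tau G v = tau_str G (tail k (min_str G u)) \<and>
    str_le (tail k (min_str G u)) (min_str G v))"
  using \<open>k \<le> jump u\<close>
proof (induction k rule: less_induct)
  case (less k)
  let ?\<alpha> = "min_str G u"
  show ?case
  proof (cases k)
    case 0
    then show ?thesis
      using assms(1) occ min_str_0[OF assms(1)] by (simp add: layer_1 occurrence_def tau_def)
  next
    case (Suc l)
    have us: "us k \<in> nodes G" "node_label G (us k) = ?\<alpha> k" "is_edge G (us k) (us l)"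
      using occ Suc by (simp_all add: occurrence_def)
    define R where "R = preds (layer G u k)"
    have "us l \<in> layer G u k" using less.IH[of l] less.prems Suc by simp
    then have us_R: "us k \<in> R"
      using us unfolding R_def preds_def by blast
    \<comment> \<open>The bound on \<open>v\<close> loses its first character, which both strings
      share, and \<open>min_str_edge\<close> carries the rest to the predecessor.\<close>
    have R: "v' \<in> nodes G" "str_le (tail k ?\<alpha>) (min_str G v')" if "v' \<in> R" for v'
    proof -
      from that obtain v where v: "v \<in> layer G u k" "is_edge G v' v"
        unfolding R_def preds_def by blast
      then have lab: "v \<in> nodes G" "node_label G v = ?\<alpha> l" "str_le (tail l ?\<alpha>) (min_str G v)"
        using less.IH[of l] less.prems Suc by simp_all
      then have "str_le (tail 1 (tail l ?\<alpha>)) (tail 1 (min_str G v))"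
        by (intro lex_le_tail) (simp_all add: min_str_0 tail_apply)
      then show "str_le (tail k ?\<alpha>) (min_str G v')"
        using lex_le_trans[OF trans_alph antisym_alph _ min_str_edge[OF v(2)]] Suc by simp
      show "v' \<in> nodes G" using is_edgeD[OF v(2)] by simp
    qed
    have R_label: "(?\<alpha> k, node_label G v') \<in> alph_le G" if "v' \<in> R" for v'
    proof -
      have "?\<alpha> k \<in> alphabet G" using us node_label_alphabet by metis
      then have "(?\<alpha> k, ?\<alpha> k) \<in> alph_le G" using refl_alph by (simp add: refl_on_def)
      moreover have "?\<alpha> k = min_str G v' 0 \<or> (?\<alpha> k, min_str G v' 0) \<in> alph_le G"
        using lex_le_head[OF R(2)[OF that]] by (simp add: tail_apply)
      ultimately show ?thesis using min_str_0 R(1)[OF that] by metis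
    qed
    have argmin: "label_argmin G R = {v\<in>R. node_label G v = ?\<alpha> k}"
    proof (rule set_eqI, rule iffI)
      fix v assume "v \<in> label_argmin G R"
      then have "v \<in> R" "(node_label G v, ?\<alpha> k) \<in> alph_le G"
        using us_R us(2) unfolding label_argmin_def by auto
      then show "v \<in> {v\<in>R. node_label G v = ?\<alpha> k}"
        using R_label[of v] antisymD[OF antisym_alph] by blast
    next
      fix v assume "v \<in> {v\<in>R. node_label G v = ?\<alpha> k}"
      then show "v \<in> label_argmin G R"
        using R_label unfolding label_argmin_def by simp
    qed
    have tau_us: "tau G (us k) = tau_str G (tail k ?\<alpha>)"
      by (rule tau_along[OF occ])
    have tau_ge: "tau_str G (tail k ?\<alpha>) \<le> tau G v" if "v \<in> label_argmin G R" for v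
    proof -
      have "v \<in> R" "node_label G v = ?\<alpha> k" using that argmin by auto
      then show ?thesis
        unfolding tau_def using R by (intro tau_str_mono) (simp_all add: tail_apply min_str_0)
    qed
    have sel: "v \<in> select G R \<longleftrightarrow> v \<in> R \<and> node_label G v = ?\<alpha> k \<and>
      tau G v = tau_str G (tail k ?\<alpha>)" for v
    proof
      assume v: "v \<in> select G R"
      then have "v \<in> label_argmin G R" unfolding select_def tau_argmin_def by simp
      moreover have "us k \<in> label_argmin G R" using us_R us argmin by simp
      then have "tau G v \<le> tau G (us k)"
        using v unfolding select_def tau_argmin_def by simp
      ultimately show "v \<in> R \<and> node_label G v = ?\<alpha> k \<and> tau G v = tau_str G (tail k ?\<alpha>)"
        using tau_ge[of v] tau_us argmin by simp
    next
      assume "v \<in> R \<and> node_label G v = ?\<alpha> k \<and> tau G v = tau_str G (tail k ?\<alpha>)"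
      then show "v \<in> select G R"
        using tau_ge argmin unfolding select_def tau_argmin_def by simp
    qed
    \<comment> \<open>Nodes of an earlier layer \<open>Suc i\<close> have minimal strings at least
      \<open>tail i ?\<alpha>\<close>, which is strictly above \<open>tail k ?\<alpha>\<close>.
      Strictness uses type 1 from index \<open>i\<close> to \<open>k - 1\<close>, hence
      \<open>1 \<le> i\<close>, which matches the removal starting at layer 2.\<close>
    have "us k \<notin> layer G u j" if j: "j \<in> {2..k}" for j
    proof
      assume "us k \<in> layer G u j"
      obtain i where i: "j = Suc i" "1 \<le> i" "i < k" using j by (cases j) auto
      then have "str_le (tail i ?\<alpha>) (min_str G (us k))"
        using less.IH[of i] less.prems \<open>us k \<in> layer G u j\<close> by simp
      then have "str_le (tail i ?\<alpha>) (tail k ?\<alpha>)" by (simp add: min_str_along[OF occ])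
      moreover have "lex_less (alph_le G) (tail k ?\<alpha>) (tail i ?\<alpha>)"
        using i less.prems by (intro lex_less_tails tau_before_jump[OF assms(1)]) simp_all
      ultimately show False
        using lex_le_less_trans[OF trans_alph antisym_alph] lex_less_irrefl by metis
    qed
    moreover have layer: "layer G u (Suc k) = select G R - (\<Union>j\<in>{2..k}. layer G u j)"
      unfolding R_def Suc by (rule layer_Suc)
    ultimately show ?thesis
      using us_R us(2) tau_us sel R by auto
  qed
qed

text \<open>The last layer is nonempty and of constant type, so \<open>the_elem\<close> is applied
  to a singleton.\<close>

lemma end_tau_eq:
  assumes "u \<in> nodes G"
  shows "end_tau G u = tau_str G (tail (jump u) (min_str G u))"
proof -
  obtain us where "occurrence G (min_str G u) u us" using min_str_occurrence[OF assms] .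
  from layer_props[OF assms this order_refl]
  have "tau G ` layer G u (ell G u) = {tau_str G (tail (jump u) (min_str G u))}"
    unfolding ell_jump[OF assms] by auto
  then show ?thesis unfolding end_tau_def by simp
qed

lemma end_tau_cases:
  assumes "u \<in> nodes G"
  shows "end_tau G u = 2 \<or> end_tau G u = 3"
  unfolding end_tau_eq[OF assms]
  using tau_jump[OF assms] tau_str_bounds(2)[of "tail (jump u) (min_str G u)"] by linarith

lemma gamma_jump: "u \<in> nodes G \<Longrightarrow> gamma G u = map (min_str G u) [0..<Suc (jump u)]"
  by (simp add: gamma_def ell_jump)

section \<open>Monotonicity of the derived labels\<close>

lemma derived_label_cong:
  assumes "u \<in> nodes G" "w \<in> nodes G" "min_str G u = min_str G w"
  shows "derived_label G u = derived_label G w"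
proof -
  have "ell G u = ell G w" using assms by (simp add: ell_eq)
  then show ?thesis
    using assms by (simp add: derived_label_def gamma_def end_tau_eq jump_def)
qed

lemma derived_label_eqD:
  assumes "u \<in> nodes G" "w \<in> nodes G" "derived_label G u = derived_label G w"
  shows "jump u = jump w" "end_tau G u = end_tau G w"
    "i \<le> jump u \<Longrightarrow> min_str G u i = min_str G w i"
proof -
  have eq: "map (min_str G u) [0..<Suc (jump u)] = map (min_str G w) [0..<Suc (jump w)]"
    using assms by (simp add: derived_label_def gamma_jump del: upt_Suc)
  from arg_cong[OF this, of length] show "jump u = jump w" by simp
  with eq show "i \<le> jump u \<Longrightarrow> min_str G u i = min_str G w i"
    by (simp add: map_eq_conv del: upt_Suc)
  show "end_tau G u = end_tau G w"
    using assms by (simp add: derived_label_def)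
qed

text \<open>The first difference \<open>n\<close> is compared with the ends of both factors. If it
  lies in both, the characters decide. Otherwise equal factors are separated by their end types, a
  longer factor of \<open>u\<close> extends that of \<open>w\<close> and is therefore smaller, and a
  longer factor of \<open>w\<close> is impossible.\<close>

lemma derived_label_mono:
  assumes u: "u \<in> nodes G" and w: "w \<in> nodes G" and le: "str_le (min_str G u) (min_str G w)"
  shows "derived_label G u = derived_label G w \<or>
    derived_less (alph_le G) (derived_label G u) (derived_label G w)"
proof (cases "min_str G u = min_str G w")
  case True
  then show ?thesis using derived_label_cong[OF u w] by simp
next
  case False
  let ?\<alpha> = "min_str G u" and ?\<beta> = "min_str G w"
  from False le obtain n where n: "\<And>i. i < n \<Longrightarrow> ?\<alpha> i = ?\<beta> i" "(?\<alpha> n, ?\<beta> n) \<in> alph_le G - Id"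
    unfolding lex_le_def lex_less_def by blast
  have tails: "tau_str G (tail k ?\<alpha>) \<le> tau_str G (tail k ?\<beta>)" if "k < n" for k
    using le n(1) that by (intro tau_str_mono lex_le_tail) (simp_all add: tail_apply)
  have take_eq: "map ?\<alpha> [0..<k] = map ?\<beta> [0..<k]" if "k \<le> n" for k
    using n(1) that by (simp add: map_eq_conv)
  consider "n \<le> jump u" "n \<le> jump w" | "jump u < n" "jump u < jump w"
    | "jump u < n" "jump u = jump w" | "jump w < n" "jump w < jump u"
    by linarith
  then show ?thesis
  proof cases
    case 1
    have split: "gamma G x = map (min_str G x) [0..<n] @ min_str G x n #
       map (min_str G x) [Suc n..<Suc (jump x)]"
      if "x \<in> nodes G" "n \<le> jump x" for x
    proof -
      have "[0..<Suc (jump x)] = [0..<n] @ n # [Suc n..<Suc (jump x)]"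
        using that(2) upt_add_eq_append[of 0 n "Suc (jump x) - n"] upt_conv_Cons[of n "Suc (jump x)"]
        by (simp del: upt_Suc)
      then show ?thesis using gamma_jump[OF that(1)] by simp
    qed
    have "(gamma G u, gamma G w) \<in> lexord (alph_le G - Id)"
      unfolding split[OF u 1(1)] split[OF w 1(2)] take_eq[OF order_refl]
      using n(2) by (intro lexord_append_leftI) simp
    moreover have "\<not> prefix (gamma G u) (gamma G w)"
      unfolding split[OF u 1(1)] split[OF w 1(2)] take_eq[OF order_refl]
      using n(2) by simp
    ultimately show ?thesis
      unfolding derived_label_def derived_less_def by simp
  next
    case 2
    \<comment> \<open>Contradictory case: the tail at \<open>jump u\<close> has type at least 2 for
      \<open>u\<close> but type 1 for \<open>w\<close>, against monotonicity.\<close>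
    then have "tau_str G (tail (jump u) ?\<beta>) = 1"
      using tau_before_jump[OF w] jump_ge_1[OF u] by simp
    then show ?thesis
      using tails[OF 2(1)] tau_jump[OF u] by simp
  next
    case 3
    then have "gamma G u = gamma G w"
      using take_eq[of "Suc (jump u)"] u w by (simp add: gamma_jump del: upt_Suc)
    moreover have "end_tau G u \<le> end_tau G w"
      using tails[OF 3(1)] 3(2) u w by (simp add: end_tau_eq)
    then have "end_tau G u = end_tau G w \<or> end_tau G u = 2 \<and> end_tau G w = 3"
      using end_tau_cases[OF u] end_tau_cases[OF w] by auto
    ultimately show ?thesis
      unfolding derived_label_def derived_less_def by auto
  next
    case 4
    have "[0..<Suc (jump u)] = [0..<Suc (jump w)] @ [Suc (jump w)..<Suc (jump u)]"
      using 4(2) upt_add_eq_append[of 0 "Suc (jump w)" "jump u - jump w"] by (simp del: upt_Suc)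
    then have "gamma G u = gamma G w @ map ?\<alpha> [Suc (jump w)..<Suc (jump u)]"
      using take_eq[of "Suc (jump w)"] 4(1) u w by (simp add: gamma_jump del: upt_Suc)
    then have "strict_prefix (gamma G w) (gamma G u)"
      using 4(2) by (simp add: strict_prefix_def del: upt_Suc)
    then show ?thesis
      unfolding derived_label_def derived_less_def by simp
  qed
qed

text \<open>The prefix guard keeps the lexicographic clause apart from the reversed prefix clause,
  so no pair is ordered both ways. Uniqueness of minima in the derived graph rests on this.\<close>

lemma derived_less_asym:
  assumes "derived_less (alph_le G) p q" "derived_less (alph_le G) q p"
  shows False
proof -
  obtain \<alpha> x \<beta> y where pq: "p = (\<alpha>, x)" "q = (\<beta>, y)" by (cases p, cases q)
  have "asym (alph_le G - Id)"
    using antisym_alph by (auto intro!: asymI dest: antisymD)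
  then have lexord: "\<not> ((\<alpha>, \<beta>) \<in> lexord (alph_le G - Id) \<and> (\<beta>, \<alpha>) \<in> lexord (alph_le G - Id))"
    using lexord_asymmetric by blast
  have prefix: "\<not> (strict_prefix \<alpha> \<beta> \<and> strict_prefix \<beta> \<alpha>)" "strict_prefix \<alpha> \<beta> \<Longrightarrow> prefix \<alpha> \<beta>"
    "strict_prefix \<beta> \<alpha> \<Longrightarrow> prefix \<beta> \<alpha>" "\<alpha> = \<beta> \<Longrightarrow> prefix \<alpha> \<beta> \<and> prefix \<beta> \<alpha> \<and> \<not> strict_prefix \<alpha> \<beta>"
    by (auto simp: strict_prefix_def)
  show False
    using assms lexord prefix unfolding pq derived_less_def prod.case by (metis numeral_eq_iff semiring_norm(88,89))
qed

lemma antisym_derived_le: "antisym (derived_le G)"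
  using derived_less_asym by (auto simp: derived_le_def intro!: antisymI)

section \<open>Minimal strings of the derived graph\<close>

lemma derived_sel: "nodes (derived G) = derived_nodes G" "alph_le (derived G) = derived_le G"
  by (simp_all add: derived_def)

lemma derived_nodes_nodes: "u \<in> derived_nodes G \<Longrightarrow> u \<in> nodes G"
  by (simp add: derived_nodes_def)

lemma is_edge_derived:
  "is_edge (derived G) v' v \<longleftrightarrow> v' \<in> derived_nodes G \<and> v \<in> derived_nodes G \<and>
     (end_tau G v = 2 \<and> v' = v \<or> end_tau G v = 3 \<and> v' \<in> layer G v (ell G v))"
  unfolding is_edge_def by (cases "derived_label G v") (auto simp: derived_def)

lemma node_label_derived:
  assumes "is_edge (derived G) v' v"
  shows "node_label (derived G) v = derived_label G v"
proof -
  from assms obtain a where "(v', v, a) \<in> edges (derived G)" unfolding is_edge_def by blast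
  moreover have "a = derived_label G v" if "(v', v, a) \<in> edges (derived G)" for v' a
    using that by (auto simp: derived_def)
  ultimately show ?thesis
    unfolding node_label_def by blast
qed

text \<open>One step of the canonical derived walk: the loop for end type 2, otherwise the end of
  the factor. The condition on \<open>min_str\<close> characterizes that end without naming an
  occurrence.\<close>

definition succ :: "'v \<Rightarrow> 'v" where
  "succ u = (if end_tau G u = 2 then u
     else SOME v. v \<in> derived_nodes G \<and> v \<in> layer G u (ell G u) \<and>
       min_str G v = tail (jump u) (min_str G u))"

lemma succ_2: "end_tau G u = 2 \<Longrightarrow> succ u = u"
  by (simp add: succ_def)

text \<open>Node \<open>jump u\<close> of any occurrence of \<open>min_str G u\<close> is a witness;
  it belongs to the derived graph because its type is the end type 3.\<close>

lemma succ_3: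
  assumes "u \<in> nodes G" "end_tau G u = 3"
  shows "succ u \<in> derived_nodes G" "succ u \<in> layer G u (ell G u)"
    "min_str G (succ u) = tail (jump u) (min_str G u)"
proof -
  let ?P = "\<lambda>v. v \<in> derived_nodes G \<and> v \<in> layer G u (ell G u) \<and>
       min_str G v = tail (jump u) (min_str G u)"
  obtain us where us: "occurrence G (min_str G u) u us"
    using min_str_occurrence[OF assms(1)] .
  then have "us (jump u) \<in> nodes G" by (simp add: occurrence_def)
  moreover have "tau G (us (jump u)) = 3"
    using tau_along[OF us] assms end_tau_eq by simp
  moreover have "us (jump u) \<in> layer G u (ell G u)"
    using layer_props[OF assms(1) us order_refl] ell_jump[OF assms(1)] by simp
  ultimately have "?P (us (jump u))"
    using min_str_along[OF us] by (simp add: derived_nodes_def)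
  then have "?P (SOME v. ?P v)" by (rule someI)
  then have "?P (succ u)" using assms(2) by (simp add: succ_def)
  then show "succ u \<in> derived_nodes G" "succ u \<in> layer G u (ell G u)"
    "min_str G (succ u) = tail (jump u) (min_str G u)" by simp_all
qed

lemma is_edge_succ: "u \<in> derived_nodes G \<Longrightarrow> is_edge (derived G) (succ u) u"
  using end_tau_cases[of u] succ_3[of u] derived_nodes_nodes[of u]
  unfolding is_edge_derived by (auto simp: succ_2)

lemma funpow_succ_derived: "u \<in> derived_nodes G \<Longrightarrow> (succ ^^ k) u \<in> derived_nodes G"
  by (induction k) (use is_edge_succ is_edge_derived in auto)

definition canonical :: "'v \<Rightarrow> nat \<Rightarrow> 'a list \<times> nat" where
  "canonical u k = derived_label G ((succ ^^ k) u)"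

lemma canonical_in: "u \<in> derived_nodes G \<Longrightarrow> canonical u \<in> strings_of (derived G) u"
  unfolding strings_of_def occurrence_def mem_Collect_eq
  using funpow_succ_derived[of u] is_edge_succ node_label_derived
  by (intro exI[of _ "\<lambda>k. (succ ^^ k) u"]) (auto simp: canonical_def derived_sel)

text \<open>Along equal labels, a derived walk from \<open>w\<close> never gets below the canonical one from \<open>u\<close>: by
  \<open>layer_props\<close> every successor of \<open>w\<close> has a minimal string at least as large as the tail of
  \<open>min_str G w\<close>.\<close>

lemma canonical_le:
  assumes u: "u \<in> derived_nodes G" and le: "str_le (min_str G u) (min_str G w)"
    and \<delta>: "\<delta> \<in> strings_of (derived G) w"
  shows "lex_le (derived_le G) (canonical u) \<delta>"
proof (rule lex_leI_first_difference)
  fix n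
  assume eq: "\<And>i. i < n \<Longrightarrow> canonical u i = \<delta> i"
  from \<delta> obtain ws where ws: "ws 0 = w" "\<And>i. is_edge (derived G) (ws (Suc i)) (ws i)"
    "\<And>i. node_label (derived G) (ws i) = \<delta> i"
    unfolding strings_of_def occurrence_def by blast
  have ws_label: "\<delta> i = derived_label G (ws i)" for i
    using node_label_derived[OF ws(2)] ws(3) by metis
  have ws_derived: "ws i \<in> derived_nodes G" for i
    using ws(2)[of i] by (simp add: is_edge_derived)
  \<comment> \<open>The inequality at \<open>k\<close> uses equal labels only below
    \<open>k\<close>, hence survives up to \<open>n\<close>, where \<open>derived_label_mono\<close>
    applies.\<close>
  have "k \<le> n \<Longrightarrow> str_le (min_str G ((succ ^^ k) u)) (min_str G (ws k))" for k
  proof (induction k)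
    case 0
    then show ?case using le ws by simp
  next
    case (Suc k)
    let ?x = "(succ ^^ k) u" and ?y = "ws k"
    have x: "?x \<in> nodes G" and y: "?y \<in> nodes G"
      using funpow_succ_derived[OF u] ws_derived derived_nodes_nodes by auto
    have "derived_label G ?x = derived_label G ?y"
      using eq[of k] Suc.prems ws_label by (simp add: canonical_def)
    note labels = derived_label_eqD[OF x y this]
    have IH: "str_le (min_str G ?x) (min_str G ?y)" using Suc by simp
    \<comment> \<open>Equal labels include equal end types, so either both walks loop or both move
      to the ends of their factors.\<close>
    show ?case
    proof (cases "end_tau G ?x = 2")
      case True
      then show ?thesis
        using IH ws(2)[of k] labels(2) by (simp add: is_edge_derived succ_2)
    next
      case False
      then have t: "end_tau G ?x = 3" "end_tau G ?y = 3"
        using end_tau_cases[OF x] labels(2) by auto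
      then have "ws (Suc k) \<in> layer G ?y (Suc (jump ?y))"
        using ws(2)[of k] ell_jump[OF y] by (simp add: is_edge_derived)
      then have "str_le (tail (jump ?y) (min_str G ?y)) (min_str G (ws (Suc k)))"
        using layer_props[OF y _ order_refl] min_str_occurrence[OF y] by metis
      moreover have "str_le (tail (jump ?x) (min_str G ?x)) (tail (jump ?x) (min_str G ?y))"
        using IH labels(3) by (intro lex_le_tail) simp_all
      ultimately show ?thesis
        using lex_le_trans[OF trans_alph antisym_alph] succ_3(3)[OF x t(1)] labels(1) by simp
    qed
  qed
  then have "canonical u n = \<delta> n \<or> derived_less (alph_le G) (canonical u n) (\<delta> n)"
    unfolding ws_label canonical_def
    using funpow_succ_derived[OF u] ws_derived derived_nodes_nodes by (intro derived_label_mono) auto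
  moreover have "canonical u n \<in> derived_alphabet G" "\<delta> n \<in> derived_alphabet G"
    unfolding ws_label canonical_def derived_alphabet_def
    using funpow_succ_derived[OF u] ws_derived by auto
  ultimately show "canonical u n = \<delta> n \<or> (canonical u n, \<delta> n) \<in> derived_le G"
    unfolding derived_le_def by auto
qed

text \<open>Starting the competitor at \<open>u\<close> itself turns \<open>canonical_le\<close>
  into minimality; antisymmetry gives the uniqueness that \<open>THE\<close> requires.\<close>

lemma min_str_derived:
  assumes "u \<in> derived_nodes G"
  shows "min_str (derived G) u = canonical u"
proof -
  have le: "lex_le (derived_le G) (canonical u) \<beta>" if "\<beta> \<in> strings_of (derived G) u" for \<beta>
    using canonical_le[OF assms _ that] by simp
  show ?thesis
    unfolding min_str_def
  proof (rule the_equality)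
    show "canonical u \<in> strings_of (derived G) u \<and>
        (\<forall>\<beta>\<in>strings_of (derived G) u. canonical u = \<beta> \<or> str_less (derived G) (canonical u) \<beta>)"
      using canonical_in[OF assms] le by (simp add: lex_le_def str_less_def derived_sel)
  next
    fix \<alpha>
    assume \<alpha>: "\<alpha> \<in> strings_of (derived G) u \<and>
        (\<forall>\<beta>\<in>strings_of (derived G) u. \<alpha> = \<beta> \<or> str_less (derived G) \<alpha> \<beta>)"
    then have "lex_le (derived_le G) \<alpha> (canonical u)"
      using canonical_in[OF assms] by (simp add: lex_le_def str_less_def derived_sel)
    then show "\<alpha> = canonical u"
      using le \<alpha> lex_le_antisym[OF antisym_derived_le] by blast
  qed
qed

section \<open>Recovering a minimal string from its canonical string\<close>

lemma tau_2_const: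
  assumes "tau_str G \<alpha> = 2"
  shows "\<alpha> i = \<alpha> 0"
proof (induction i)
  case (Suc i)
  have "tail 1 \<alpha> = \<alpha>" using assms by (simp add: tau_str_tail split: if_splits)
  from fun_cong[OF this, of i] show ?case using Suc by (simp add: tail_apply)
qed simp

text \<open>Each character is recovered by induction on its position: within the first factor from
  \<open>gamma\<close>, beyond it from the constant tail (end type 2) or from \<open>succ u\<close>,
  at a position smaller by \<open>jump u \<ge> 1\<close>.\<close>

lemma canonical_inject:
  assumes "u \<in> derived_nodes G" "w \<in> derived_nodes G" "canonical u = canonical w"
  shows "min_str G u = min_str G w"
proof
  fix n
  show "min_str G u n = min_str G w n"
    using assms
  proof (induction n arbitrary: u w rule: less_induct)
    case (less n)
    note u = derived_nodes_nodes[OF less.prems(1)] and w = derived_nodes_nodes[OF less.prems(2)]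
    have "derived_label G u = derived_label G w"
      using fun_cong[OF less.prems(3), of 0] by (simp add: canonical_def)
    note labels = derived_label_eqD[OF u w this]
    show ?case
    proof (cases "n \<le> jump u")
      case True
      then show ?thesis by (rule labels(3))
    next
      case False
      let ?m = "n - jump u"
      have n: "min_str G u n = tail (jump u) (min_str G u) ?m"
        "min_str G w n = tail (jump w) (min_str G w) ?m"
        using False labels(1) by (simp_all add: tail_apply)
      show ?thesis
      proof (cases "end_tau G u = 2")
        case True
        \<comment> \<open>Both tails are constant, and their value is the last character of the
          common factor.\<close>
        then have "tau_str G (tail (jump u) (min_str G u)) = 2"
          "tau_str G (tail (jump w) (min_str G w)) = 2"
          using labels(2) by (simp_all add: end_tau_eq u w)
        from tau_2_const[OF this(1), of ?m] tau_2_const[OF this(2), of ?m] show ?thesis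
          unfolding n using labels(1) labels(3)[OF order_refl] by (simp add: tail_apply)
      next
        case False
        then have t: "end_tau G u = 3" "end_tau G w = 3"
          using end_tau_cases[OF u] labels(2) by auto
        \<comment> \<open>Dropping the first label of a canonical string gives the canonical string
          of \<open>succ\<close>.\<close>
        have "canonical (succ u) = canonical (succ w)"
          using fun_cong[OF less.prems(3), of "Suc _"]
          by (intro ext) (simp add: canonical_def funpow_swap1)
        moreover have "?m < n"
          using jump_ge_1[OF u] \<open>\<not> n \<le> jump u\<close> by simp
        ultimately have "min_str G (succ u) ?m = min_str G (succ w) ?m"
          using less.IH succ_3(1)[OF u t(1)] succ_3(1)[OF w t(2)] by blast
        then show ?thesis
          unfolding n succ_3(3)[OF u t(1)] succ_3(3)[OF w t(2)] .
      qed
    qed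
  qed
qed

end

theorem theorem21:
  fixes G :: "('v, 'a) ograph" and u v :: 'v
  assumes "standard_graph G"
    and "u \<in> nodes G" and "v \<in> nodes G"
    and "tau G u = 3" and "tau G v = 3"
  shows "(min_str G u = min_str G v \<longrightarrow> min_str (derived G) u = min_str (derived G) v) \<and>
         (str_less G (min_str G u) (min_str G v) \<longrightarrow>
            str_less (derived G) (min_str (derived G) u) (min_str (derived G) v))"
proof -
  interpret standard_graph G by fact
  have u: "u \<in> derived_nodes G" and v: "v \<in> derived_nodes G"
    using assms by (simp_all add: derived_nodes_def)
  \<comment> \<open>The competitor in \<open>canonical_le\<close> may start at another node, so the
    canonical string of \<open>y\<close> serves as one.\<close>
  have le: "lex_le (derived_le G) (canonical x) (canonical y)"
    if "x \<in> derived_nodes G" "y \<in> derived_nodes G" "str_le (min_str G x) (min_str G y)" for x y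
    using canonical_le[OF that(1,3) canonical_in[OF that(2)]] .
  show ?thesis
  proof (intro conjI impI)
    assume "min_str G u = min_str G v"
    then show "min_str (derived G) u = min_str (derived G) v"
      using le[OF u v] le[OF v u] lex_le_antisym[OF antisym_derived_le]
      by (simp add: min_str_derived u v)
  next
    assume less: "str_less G (min_str G u) (min_str G v)"
    then have "lex_le (derived_le G) (canonical u) (canonical v)"
      by (intro le u v) (simp add: lex_le_def str_less_def)
    \<comment> \<open>Injectivity of the canonical string makes the inequality strict.\<close>
    moreover have "canonical u \<noteq> canonical v"
      using less canonical_inject[OF u v] by (auto simp: str_less_def)
    ultimately show "str_less (derived G) (min_str (derived G) u) (min_str (derived G) v)"
      by (simp add: min_str_derived u v lex_le_def str_less_def derived_sel)
  qed
qed

end
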